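(* Let $L=2l$ and let $$q(x)=A\sum_{n=-\infty}^{\infty}\bigl[\delta(x-(2n+1)l)-\delta(x-2nl)\bigr],\qquad A\to\infty .$$ Let $t_N(\omega)$ be the transmission coefficient for the potential $q$ truncated to $N$ periods. Let $\omega\in\Delta$, where $\Delta$ is an interval centered at $\omega_n=\frac{n\pi}{l}$, $n\ge1$, and let $|\Delta|=o(A^{-1})$. Then $$|t_N(\omega)|^2\sim\frac{4}{\omega^{-2}A^2\sin^2Nk(\omega)+4},$$ where $\cos k(\omega)=F(\omega)$ with $$F(\omega)=\cos\omega L-\frac{A^2}{2\omega^2}\sin^2\omega l .$$
   Context: $\delta$ is the Dirac delta function, and $|\Delta|$ is the length of $\Delta$ (which depends on $A$); $\sim$ means that the ratio of the two sides tends to $1$ as $A\to\infty$. $F(\omega)$ is the half-trace of the monodromy matrix over one period (from $x=0^-$ to $x=L^-$) of the operator $-\frac{d^2}{dx^2}+q$. The truncated operator is $H_N=-\frac{d^2}{dx^2}+q_N$, where $q_N$ consists of the delta functions of $q$ in $N$ complete periods starting at $x=0^-$, i.e. $q_N=A\sum_{n=0}^{N-1}[\delta(x-(2n+1)l)-\delta(x-2nl)]$. The scattering solution of $H_N\psi=\omega^2\psi$ satisfies $\psi=e^{i\omega x}+r_Ne^{-i\omega x}$ for $x<0$ and $\psi=t_Ne^{i\omega x}$ for $x>NL$; $t_N=t_N(\omega)$ is the transmission coefficient. *)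

theory Defs
  imports "HOL-Analysis.Analysis" "HOL-Library.Landau_Symbols"
begin

text \<open>
  A point-interaction potential \<open>\<Sum>y. q y * \<delta>(x - y)\<close> is encoded by its weight function
  \<open>q :: real \<Rightarrow> real\<close>; its support \<open>{y. q y \<noteq> 0}\<close> is meant to be a closed discrete set.
  Thus \<open>indicator {y}\<close> encodes \<open>\<delta>(x - y)\<close>.
  A solution of \<open>- \<psi>'' + q \<psi> = E \<psi>\<close> is, as usual, a continuous function that solves
  \<open>- \<psi>'' = E \<psi>\<close> off the support and satisfies \<open>\<psi>'(x+) - \<psi>'(x-) = q x * \<psi> x\<close> at each
  \<open>x\<close> in the support.
\<close>

definition schroedinger_solution ::
    "(real \<Rightarrow> real) \<Rightarrow> real \<Rightarrow> (real \<Rightarrow> 'a::real_normed_vector) \<Rightarrow> bool" where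
  "schroedinger_solution q E \<psi> \<longleftrightarrow>
     continuous_on UNIV \<psi> \<and>
     (\<forall>x. q x = 0 \<longrightarrow>
        \<psi> differentiable (at x) \<and>
        ((\<lambda>y. vector_derivative \<psi> (at y)) has_vector_derivative - (E *\<^sub>R \<psi> x)) (at x)) \<and>
     (\<forall>x. q x \<noteq> 0 \<longrightarrow>
        (\<exists>dl dr. ((\<lambda>y. vector_derivative \<psi> (at y)) \<longlongrightarrow> dl) (at_left x) \<and>
                 ((\<lambda>y. vector_derivative \<psi> (at y)) \<longlongrightarrow> dr) (at_right x) \<and>
                 dr - dl = q x *\<^sub>R \<psi> x))"

text \<open>Cauchy data \<open>(\<psi>(x-), \<psi>'(x-))\<close>; solutions are continuous, so \<open>\<psi>(x-) = \<psi> x\<close>.\<close>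

definition left_data :: "(real \<Rightarrow> real) \<Rightarrow> real \<Rightarrow> real ^ 2" where
  "left_data \<psi> x = vector [\<psi> x, Lim (at_left x) (\<lambda>y. vector_derivative \<psi> (at y))]"

definition monodromy_matrix ::
    "(real \<Rightarrow> real) \<Rightarrow> real \<Rightarrow> real \<Rightarrow> real \<Rightarrow> real ^ 2 ^ 2" where
  "monodromy_matrix q E a b =
     (THE M. \<forall>\<psi>. schroedinger_solution q E \<psi> \<longrightarrow> left_data \<psi> b = M *v left_data \<psi> a)"

definition dirac_comb :: "real \<Rightarrow> real \<Rightarrow> real \<Rightarrow> real" where
  "dirac_comb l A x =
     A * (indicator (range (\<lambda>n::int. (2 * of_int n + 1) * l)) x
          - indicator (range (\<lambda>n::int. 2 * of_int n * l)) x)"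

definition truncated_comb :: "real \<Rightarrow> real \<Rightarrow> nat \<Rightarrow> real \<Rightarrow> real" where
  "truncated_comb l A N x =
     A * (\<Sum>n<N. indicator {(2 * real n + 1) * l} x - indicator {2 * real n * l} x)"

definition half_trace :: "real \<Rightarrow> real \<Rightarrow> real \<Rightarrow> real" where
  "half_trace l A \<omega> = trace (monodromy_matrix (dirac_comb l A) (\<omega>\<^sup>2) 0 (2 * l)) / 2"

definition scattering_solution ::
    "real \<Rightarrow> real \<Rightarrow> nat \<Rightarrow> real \<Rightarrow> (real \<Rightarrow> complex) \<Rightarrow> complex \<Rightarrow> complex \<Rightarrow> bool" where
  "scattering_solution l A N \<omega> \<psi> r t \<longleftrightarrow>
     schroedinger_solution (truncated_comb l A N) (\<omega>\<^sup>2) \<psi> \<and>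
     (\<forall>x<0. \<psi> x = exp (\<i> * of_real (\<omega> * x)) + r * exp (- \<i> * of_real (\<omega> * x))) \<and>
     (\<forall>x>real N * (2 * l). \<psi> x = t * exp (\<i> * of_real (\<omega> * x)))"

definition transmission_coefficient :: "real \<Rightarrow> real \<Rightarrow> nat \<Rightarrow> real \<Rightarrow> complex" where
  "transmission_coefficient l A N \<omega> = (THE t. \<exists>\<psi> r. scattering_solution l A N \<omega> \<psi> r t)"

definition interval_centered_at :: "real \<Rightarrow> real set \<Rightarrow> bool" where
  "interval_centered_at c S \<longleftrightarrow> (\<exists>r>0. S = {c - r<..<c + r} \<or> S = {c - r..c + r})"

end

theory Submission
  imports Defs
begin

text \<open>
  Cauchy data at lattice points propagate by a transfer matrix \<open>M\<close> over one period, which in the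
  normalised coordinates \<open>(\<psi>, \<psi>' / \<omega>)\<close> has determinant \<open>1\<close> and half-trace \<open>F = cos k\<close>. By
  Cayley-Hamilton, \<open>M ^ N\<close> is a combination of \<open>M\<close> and the identity with Chebyshev coefficients, the
  coefficient of \<open>M\<close> being \<open>S = sin (N k) / sin k\<close>. Matching with plane waves gives
  \<open>|t|\<^sup>2 = 4 / (X + 4)\<close>, where \<open>X = S\<^sup>2 b\<^sup>2 (4 + b\<^sup>2) sin\<^sup>2 (\<omega> l)\<close> and \<open>b = A / \<omega>\<close>. Since
  \<open>sin\<^sup>2 k = 1 - F\<^sup>2 = (4 + b\<^sup>2) sin\<^sup>2 (\<omega> l) (1 - \<eta>)\<close> with \<open>\<eta> = (4 + b\<^sup>2) sin\<^sup>2 (\<omega> l) / 4\<close>, the two sides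
  of the claim have ratio \<open>1 - \<eta> X / (X + 4)\<close>, and \<open>\<eta>\<close> tends to \<open>0\<close> because
  \<open>|sin (\<omega> l)| \<le> l |\<Delta>| = o(1 / A)\<close>.
\<close>

subsection \<open>Solutions between point interactions\<close>

text \<open>The second Cauchy datum of \<open>left_data\<close>, for values in any normed space: the
  monodromy matrix concerns real solutions, scattering concerns complex ones.\<close>

definition left_deriv :: "(real \<Rightarrow> 'a::real_normed_vector) \<Rightarrow> real \<Rightarrow> 'a" where
  "left_deriv \<psi> x = Lim (at_left x) (\<lambda>y. vector_derivative \<psi> (at y))"

lemma left_data_eq: "left_data \<psi> x = vector [\<psi> x, left_deriv \<psi> x]"
  by (simp add: left_data_def left_deriv_def)

lemma left_deriv_eqI:
  "((\<lambda>y. vector_derivative \<psi> (at y)) \<longlongrightarrow> d) (at_left x) \<Longrightarrow> left_deriv \<psi> x = d"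
  unfolding left_deriv_def by (rule tendsto_Lim) auto

text \<open>The solution of \<open>- \<psi>'' = w\<^sup>2 \<psi>\<close> with value \<open>p\<close>
  and derivative \<open>d\<close> at \<open>a\<close>. Its scalar coefficients are real, so real and
  complex waves are treated alike.\<close>

definition free_wave :: "real \<Rightarrow> real \<Rightarrow> 'a \<Rightarrow> 'a \<Rightarrow> real \<Rightarrow> 'a::real_normed_vector" where
  "free_wave w a p d x = cos (w * (x - a)) *\<^sub>R p + (sin (w * (x - a)) / w) *\<^sub>R d"

definition free_wave' :: "real \<Rightarrow> real \<Rightarrow> 'a \<Rightarrow> 'a \<Rightarrow> real \<Rightarrow> 'a::real_normed_vector" where
  "free_wave' w a p d x = - (w * sin (w * (x - a))) *\<^sub>R p + cos (w * (x - a)) *\<^sub>R d"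

lemma free_wave_has_vector_derivative:
  assumes "w \<noteq> 0"
  shows "(free_wave w a p d has_vector_derivative free_wave' w a p d x) (at x within S)"
  unfolding free_wave_def[abs_def] free_wave'_def using assms
  by (auto intro!: derivative_eq_intros has_vector_derivative_scaleR
      simp: has_real_derivative_iff_has_vector_derivative[symmetric])

lemma free_wave'_has_vector_derivative:
  assumes "w \<noteq> 0"
  shows "(free_wave' w a p d has_vector_derivative - (w\<^sup>2 *\<^sub>R free_wave w a p d x)) (at x within S)"
  unfolding free_wave'_def[abs_def] free_wave_def
proof -
  have "((\<lambda>x. - (w * sin (w * (x - a)))) has_vector_derivative - (w\<^sup>2 * cos (w * (x - a)))) (at x within S)"
    unfolding has_real_derivative_iff_has_vector_derivative[symmetric]
    by (auto intro!: derivative_eq_intros simp: power2_eq_square)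
  moreover have "((\<lambda>x. cos (w * (x - a))) has_vector_derivative - (w * sin (w * (x - a)))) (at x within S)"
    unfolding has_real_derivative_iff_has_vector_derivative[symmetric]
    by (auto intro!: derivative_eq_intros)
  ultimately show "((\<lambda>x. - (w * sin (w * (x - a))) *\<^sub>R p + cos (w * (x - a)) *\<^sub>R d) has_vector_derivative
      - (w\<^sup>2 *\<^sub>R (cos (w * (x - a)) *\<^sub>R p + (sin (w * (x - a)) / w) *\<^sub>R d))) (at x within S)"
    using assms by (auto intro!: derivative_eq_intros has_vector_derivative_scaleR
        simp: power2_eq_square algebra_simps)
qed

lemma free_wave_at [simp]: "free_wave w a p d a = p" "free_wave' w a p d a = d"
  by (auto simp: free_wave_def free_wave'_def)

lemma tendsto_free_wave:
  assumes "w \<noteq> 0"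
  shows "(free_wave w a p d \<longlongrightarrow> free_wave w a p d x) (at x within S)"
    "(free_wave' w a p d \<longlongrightarrow> free_wave' w a p d x) (at x within S)"
  using has_vector_derivative_continuous[OF free_wave_has_vector_derivative[OF assms]]
    has_vector_derivative_continuous[OF free_wave'_has_vector_derivative[OF assms]]
  by (auto simp: continuous_within)

text \<open>A free solution is determined by its Cauchy data at any point, so the base point may be
  moved; the addition theorems verify this.\<close>

lemma free_wave_shift:
  assumes "w \<noteq> 0"
  shows "free_wave w b (free_wave w a p d b) (free_wave' w a p d b) x = free_wave w a p d x"
proof -
  have e: "w * (x - a) = w * (x - b) + w * (b - a)" by (simp add: algebra_simps)
  show ?thesis
    unfolding free_wave_def free_wave'_def e sin_add cos_add using assms
    by (simp add: algebra_simps add_divide_distrib diff_divide_distrib)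
qed

lemma free_wave_eq_on_open:
  assumes "w \<noteq> 0" "open S" "x \<in> S" and eq: "\<And>y. y \<in> S \<Longrightarrow> \<psi> y = free_wave w a p d y"
  shows "\<psi> differentiable (at x)"
    "vector_derivative \<psi> (at x) = free_wave' w a p d x"
    "((\<lambda>y. vector_derivative \<psi> (at y)) has_vector_derivative - (w\<^sup>2 *\<^sub>R \<psi> x)) (at x)"
proof -
  have hd: "(\<psi> has_vector_derivative free_wave' w a p d y) (at y)" if "y \<in> S" for y
    by (rule has_vector_derivative_transform_within_open
        [OF free_wave_has_vector_derivative[OF assms(1)] \<open>open S\<close> that]) (simp add: eq)
  show "\<psi> differentiable (at x)" using hd[OF \<open>x \<in> S\<close>] by (rule differentiableI_vector)
  have vd: "vector_derivative \<psi> (at y) = free_wave' w a p d y" if "y \<in> S" for y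
    using hd[OF that] by (rule vector_derivative_at)
  show "vector_derivative \<psi> (at x) = free_wave' w a p d x" using vd[OF \<open>x \<in> S\<close>] .
  show "((\<lambda>y. vector_derivative \<psi> (at y)) has_vector_derivative - (w\<^sup>2 *\<^sub>R \<psi> x)) (at x)"
    unfolding eq[OF \<open>x \<in> S\<close>]
    by (rule has_vector_derivative_transform_within_open
        [OF free_wave'_has_vector_derivative[OF assms(1)] \<open>open S\<close> \<open>x \<in> S\<close>]) (simp add: vd)
qed

text \<open>Off the support the derivative is continuous, so the jump condition holds there too,
  with jump zero. This spares later arguments the case distinction.\<close>

lemma one_sided_derivatives:
  assumes "schroedinger_solution q E \<psi>"
  obtains dr where
    "((\<lambda>y. vector_derivative \<psi> (at y)) \<longlongrightarrow> left_deriv \<psi> x) (at_left x)"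
    "((\<lambda>y. vector_derivative \<psi> (at y)) \<longlongrightarrow> dr) (at_right x)"
    "dr = left_deriv \<psi> x + q x *\<^sub>R \<psi> x"
proof -
  let ?D = "\<lambda>y. vector_derivative \<psi> (at y)"
  have "\<exists>dl dr. (?D \<longlongrightarrow> dl) (at_left x) \<and> (?D \<longlongrightarrow> dr) (at_right x) \<and> dr - dl = q x *\<^sub>R \<psi> x"
  proof (cases "q x = 0")
    case True
    then have "isCont ?D x"
      using assms by (auto simp: schroedinger_solution_def dest: has_vector_derivative_continuous)
    then have "(?D \<longlongrightarrow> ?D x) (at x)" by (simp add: isCont_def)
    then show ?thesis using True by (auto simp: filterlim_at_split)
  next
    case False
    then show ?thesis using assms by (auto simp: schroedinger_solution_def)
  qed
  then obtain dl dr where "(?D \<longlongrightarrow> dl) (at_left x)" "(?D \<longlongrightarrow> dr) (at_right x)"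
      "dr - dl = q x *\<^sub>R \<psi> x"
    by blast
  then show ?thesis using that[of dr] left_deriv_eqI[of \<psi> dl x] by (metis diff_add_cancel add.commute)
qed

text \<open>Variation of constants: \<open>f\<close> and \<open>g\<close> carry the Cauchy data at
  \<open>y\<close> back to \<open>a\<close> along the free flow. The equation makes their
  derivatives vanish, so they are constant on the convex set \<open>S\<close>.\<close>

lemma solution_free_on_interval:
  fixes \<psi> :: "real \<Rightarrow> 'a::real_normed_vector"
  assumes sol: "schroedinger_solution q (w\<^sup>2) \<psi>" and w: "w \<noteq> 0"
    and S: "open S" "convex S" and q: "\<And>x. x \<in> S \<Longrightarrow> q x = 0"
  shows "\<exists>p d. \<forall>x\<in>S. \<psi> x = free_wave w a p d x"
proof -
  define D where "D = (\<lambda>y. vector_derivative \<psi> (at y))"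
  define f where "f = (\<lambda>y. cos (w * (y - a)) *\<^sub>R \<psi> y - (sin (w * (y - a)) / w) *\<^sub>R D y)"
  define g where "g = (\<lambda>y. (w * sin (w * (y - a))) *\<^sub>R \<psi> y + cos (w * (y - a)) *\<^sub>R D y)"
  have p1: "(\<psi> has_vector_derivative D x) (at x)"
    and p2: "(D has_vector_derivative - (w\<^sup>2 *\<^sub>R \<psi> x)) (at x)" if "x \<in> S" for x
    using sol q[OF that] by (auto simp: schroedinger_solution_def D_def vector_derivative_works)
  have c: "((\<lambda>x. cos (w * (x - a))) has_vector_derivative - (w * sin (w * (x - a)))) (at x)"
    and s1: "((\<lambda>x. sin (w * (x - a)) / w) has_vector_derivative cos (w * (x - a))) (at x)"
    and s2: "((\<lambda>x. w * sin (w * (x - a))) has_vector_derivative w\<^sup>2 * cos (w * (x - a))) (at x)" for x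
    unfolding has_real_derivative_iff_has_vector_derivative[symmetric] using w
    by (auto intro!: derivative_eq_intros simp: power2_eq_square)
  have f': "(f has_vector_derivative 0) (at x)" if "x \<in> S" for x
    unfolding f_def using w
    by (auto intro!: derivative_eq_intros has_vector_derivative_scaleR c s1 p1 p2 that
        simp: has_real_derivative_iff_has_vector_derivative power2_eq_square)
  have g': "(g has_vector_derivative 0) (at x)" if "x \<in> S" for x
    unfolding g_def using w
    by (auto intro!: derivative_eq_intros has_vector_derivative_scaleR c s2 p1 p2 that
        simp: has_real_derivative_iff_has_vector_derivative power2_eq_square
          algebra_simps)
  obtain p where p: "\<And>x. x \<in> S \<Longrightarrow> f x = p"
    using has_vector_derivative_zero_constant[OF S(2), of f] f' has_vector_derivative_at_within by blast
  obtain d where d: "\<And>x. x \<in> S \<Longrightarrow> g x = d"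
    using has_vector_derivative_zero_constant[OF S(2), of g] g' has_vector_derivative_at_within by blast
  \<comment> \<open>Flowing back to \<open>a\<close> and forward again is the identity, by
    \<open>sin\<^sup>2 + cos\<^sup>2 = 1\<close>.\<close>
  have "\<psi> x = free_wave w a (f x) (g x) x" for x
  proof -
    have "c *\<^sub>R (c *\<^sub>R y - (s / w) *\<^sub>R z) + (s / w) *\<^sub>R ((w * s) *\<^sub>R y + c *\<^sub>R z) = (s\<^sup>2 + c\<^sup>2) *\<^sub>R y"
      for c s :: real and y z :: 'a
      using w by (simp add: algebra_simps power2_eq_square)
    from this[of "cos (w * (x - a))" "\<psi> x" "sin (w * (x - a))" "D x"]
    have "free_wave w a (f x) (g x) x = ((sin (w * (x - a)))\<^sup>2 + (cos (w * (x - a)))\<^sup>2) *\<^sub>R \<psi> x"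
      by (simp add: free_wave_def f_def g_def)
    then show ?thesis by simp
  qed
  then show ?thesis using p d by metis
qed

lemma solution_isCont:
  "schroedinger_solution q E \<psi> \<Longrightarrow> (\<psi> \<longlongrightarrow> \<psi> x) (at x within S)"
  by (auto simp: schroedinger_solution_def continuous_on_def intro: tendsto_within_subset)

text \<open>The free form on the open interval extends to both ends by one-sided limits. The limit
  of the derivative at \<open>a\<close> comes from the right, hence the jump term; at
  \<open>b\<close> it comes from the left, so a point interaction at \<open>b\<close> has no
  effect.\<close>

lemma solution_right_of:
  assumes sol: "schroedinger_solution q (w\<^sup>2) \<psi>" and w: "w \<noteq> 0" and "a < b"
    and q: "\<And>x. a < x \<Longrightarrow> x < b \<Longrightarrow> q x = 0"
  shows "\<And>x. a \<le> x \<Longrightarrow> x \<le> b \<Longrightarrow> \<psi> x = free_wave w a (\<psi> a) (left_deriv \<psi> a + q a *\<^sub>R \<psi> a) x"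
    and "left_deriv \<psi> b = free_wave' w a (\<psi> a) (left_deriv \<psi> a + q a *\<^sub>R \<psi> a) b"
proof -
  let ?D = "\<lambda>y. vector_derivative \<psi> (at y)" and ?S = "{a<..<b}"
  obtain p d where pd: "\<And>x. x \<in> ?S \<Longrightarrow> \<psi> x = free_wave w a p d x"
    using solution_free_on_interval[OF sol w, of ?S a] q by auto
  have D: "?D x = free_wave' w a p d x" if "x \<in> ?S" for x
    by (rule free_wave_eq_on_open[OF w _ that pd]) auto
  have ev: "eventually (\<lambda>x. x \<in> ?S) (at_right a)" "eventually (\<lambda>x. x \<in> ?S) (at_left b)"
    using eventually_at_right_real[OF \<open>a < b\<close>] eventually_at_left_real[OF \<open>a < b\<close>] by auto
  have "(\<psi> \<longlongrightarrow> p) (at_right a)"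
    by (rule Lim_transform_eventually[OF tendsto_free_wave(1)[OF w, of a p d a, simplified]])
      (use ev(1) pd in \<open>auto elim: eventually_mono\<close>)
  then have p: "p = \<psi> a"
    using solution_isCont[OF sol] by (intro tendsto_unique[of "at_right a" \<psi>]) auto
  have "(\<psi> \<longlongrightarrow> free_wave w a p d b) (at_left b)"
    by (rule Lim_transform_eventually[OF tendsto_free_wave(1)[OF w]])
      (use ev(2) pd in \<open>auto elim: eventually_mono\<close>)
  then have pb: "free_wave w a p d b = \<psi> b"
    using solution_isCont[OF sol] by (intro tendsto_unique[of "at_left b" \<psi>]) auto
  obtain dr where dr: "(?D \<longlongrightarrow> dr) (at_right a)" "dr = left_deriv \<psi> a + q a *\<^sub>R \<psi> a"
    using one_sided_derivatives[OF sol] by metis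
  have "(?D \<longlongrightarrow> d) (at_right a)"
    by (rule Lim_transform_eventually[OF tendsto_free_wave(2)[OF w, of a p d a, simplified]])
      (use ev(1) D in \<open>auto elim: eventually_mono\<close>)
  then have d: "d = left_deriv \<psi> a + q a *\<^sub>R \<psi> a"
    using dr by (metis tendsto_unique trivial_limit_at_right_real)
  have "(?D \<longlongrightarrow> free_wave' w a p d b) (at_left b)"
    by (rule Lim_transform_eventually[OF tendsto_free_wave(2)[OF w]])
      (use ev(2) D in \<open>auto elim: eventually_mono\<close>)
  then show "left_deriv \<psi> b = free_wave' w a (\<psi> a) (left_deriv \<psi> a + q a *\<^sub>R \<psi> a) b"
    using left_deriv_eqI p d by metis
  fix x assume "a \<le> x" "x \<le> b"
  then consider "x = a" | "x = b" | "x \<in> ?S" by fastforce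
  then show "\<psi> x = free_wave w a (\<psi> a) (left_deriv \<psi> a + q a *\<^sub>R \<psi> a) x"
    using pd pb p d by cases auto
qed

text \<open>Here \<open>a\<close> is approached from the left only, so the left data enter without a
  jump.\<close>

lemma solution_left_of:
  assumes sol: "schroedinger_solution q (w\<^sup>2) \<psi>" and w: "w \<noteq> 0"
    and q: "\<And>x. x < a \<Longrightarrow> q x = 0" and "x \<le> a"
  shows "\<psi> x = free_wave w a (\<psi> a) (left_deriv \<psi> a) x"
proof -
  let ?D = "\<lambda>y. vector_derivative \<psi> (at y)" and ?S = "{..<a}"
  obtain p d where pd: "\<And>x. x \<in> ?S \<Longrightarrow> \<psi> x = free_wave w a p d x"
    using solution_free_on_interval[OF sol w, of ?S a] q by auto
  have D: "?D x = free_wave' w a p d x" if "x \<in> ?S" for x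
    by (rule free_wave_eq_on_open[OF w _ that pd]) auto
  have ev: "eventually (\<lambda>x. x \<in> ?S) (at_left a)"
    by (simp add: eventually_at_filter)
  have "(\<psi> \<longlongrightarrow> p) (at_left a)"
    by (rule Lim_transform_eventually[OF tendsto_free_wave(1)[OF w, of a p d a, simplified]])
      (use ev pd in \<open>auto elim: eventually_mono\<close>)
  then have p: "p = \<psi> a"
    using solution_isCont[OF sol] by (intro tendsto_unique[of "at_left a" \<psi>]) auto
  have "(?D \<longlongrightarrow> d) (at_left a)"
    by (rule Lim_transform_eventually[OF tendsto_free_wave(2)[OF w, of a p d a, simplified]])
      (use ev D in \<open>auto elim: eventually_mono\<close>)
  then have "left_deriv \<psi> a = d" by (rule left_deriv_eqI)
  with p pd \<open>x \<le> a\<close> show ?thesis by (cases "x = a") auto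
qed

subsection \<open>Existence of solutions for lattice potentials\<close>

text \<open>To the right the sequence is iterated with \<open>f\<close>, to the left with
  \<open>g\<close>; a right inverse suffices because the leftward step only has to be undone by
  \<open>f\<close>.\<close>

lemma int_recursion_exists:
  fixes f g :: "int \<Rightarrow> 'b \<Rightarrow> 'b"
  assumes "\<And>m y. f m (g m y) = y"
  obtains u where "u 0 = y0" "\<And>m. u (m + 1) = f m (u m)"
proof -
  define fw where "fw = rec_nat y0 (\<lambda>n. f (int n))"
  \<comment> \<open>\<open>bw n\<close> is the value at \<open>- n\<close>, so its next step must
    undo \<open>f (- n - 1)\<close>.\<close>
  define bw where "bw = rec_nat y0 (\<lambda>n. g (- int n - 1))"
  define u where "u = (\<lambda>m. if m \<ge> 0 then fw (nat m) else bw (nat (- m)))"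
  have "u 0 = y0" by (simp add: u_def fw_def)
  moreover have "u (m + 1) = f m (u m)" for m
  proof (cases "m \<ge> 0")
    case True
    then show ?thesis by (simp add: u_def fw_def nat_add_distrib)
  next
    case False
    then obtain k where m: "m = - int k - 1"
      by (intro that[of "nat (- m - 1)"]) simp
    have "f m (u m) = bw k" by (simp add: u_def m bw_def assms nat_add_distrib)
    also have "bw k = u (m + 1)" by (cases k) (simp_all add: u_def m bw_def fw_def nat_add_distrib)
    finally show ?thesis ..
  qed
  ultimately show ?thesis using that by blast
qed

text \<open>Free waves on the cells between neighbouring lattice points are glued together; a
  two-sided recursion supplies their Cauchy data. Lattice points of weight zero are allowed, so the
  infinite and the truncated comb are both covered.\<close>

lemma lattice_solution_exists:
  fixes p d :: "'a::real_normed_vector"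
  assumes l: "l > 0" and w: "w \<noteq> 0"
    and q: "\<And>x. q x \<noteq> 0 \<Longrightarrow> x \<in> range (\<lambda>m::int. of_int m * l)"
  obtains \<psi> where "schroedinger_solution q (w\<^sup>2) \<psi>" "\<psi> 0 = p" "left_deriv \<psi> 0 = d"
proof -
  define v where "v = (\<lambda>m::int. q (of_int m * l))"
  \<comment> \<open>\<open>f m\<close> takes the left data at the \<open>m\<close>-th lattice point
    through the jump and then along the free flow over length \<open>l\<close>; \<open>g m\<close>
    flows back and removes the jump.\<close>
  define f :: "int \<Rightarrow> 'a \<times> 'a \<Rightarrow> 'a \<times> 'a" where
    "f = (\<lambda>m (p, d). (free_wave w 0 p (d + v m *\<^sub>R p) l, free_wave' w 0 p (d + v m *\<^sub>R p) l))"
  define g :: "int \<Rightarrow> 'a \<times> 'a \<Rightarrow> 'a \<times> 'a" where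
    "g = (\<lambda>m (p, d). (free_wave w l p d 0, free_wave' w l p d 0 - v m *\<^sub>R free_wave w l p d 0))"
  have fg: "f m (g m y) = y" for m y
  proof -
    have "(cos (l * w) * cos (l * w)) *\<^sub>R z + (sin (l * w) * sin (l * w)) *\<^sub>R z = z" for z :: 'a
      by (metis (no_types) power2_eq_square scaleR_add_left scaleR_one sin_cos_squared_add2)
    then show ?thesis
      using w by (cases y) (simp add: f_def g_def free_wave_def free_wave'_def algebra_simps)
  qed
  obtain u where u0: "u 0 = (p, d)" and u: "\<And>m. u (m + 1) = f m (u m)"
    using int_recursion_exists[of f g "(p, d)", OF fg] by metis
  \<comment> \<open>At the \<open>m\<close>-th lattice point: the value \<open>P m\<close>, the left derivative \<open>D m\<close> and the right derivative \<open>R m\<close>.\<close>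
  define P where "P = fst \<circ> u"
  define D where "D = snd \<circ> u"
  define R where "R = (\<lambda>m. D m + v m *\<^sub>R P m)"
  have step: "P (m + 1) = free_wave w 0 (P m) (R m) l" "D (m + 1) = free_wave' w 0 (P m) (R m) l" for m
    unfolding P_def D_def R_def comp_def u f_def by (auto split: prod.splits)
  define a where "a = (\<lambda>m::int. of_int m * l)"
  have a1: "a (m - 1) = a m - l" "a (m + 1) = a m + l" for m by (auto simp: a_def algebra_simps)
  define \<psi> where "\<psi> = (\<lambda>x. free_wave w (a \<lfloor>x / l\<rfloor>) (P \<lfloor>x / l\<rfloor>) (R \<lfloor>x / l\<rfloor>) x)"
  have right: "\<psi> x = free_wave w (a m) (P m) (R m) x" if "a m \<le> x" "x < a m + l" for m x
  proof -
    have "\<lfloor>x / l\<rfloor> = m" using that l by (simp add: floor_eq_iff a_def field_simps)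
    then show ?thesis by (simp add: \<psi>_def)
  qed
  \<comment> \<open>The wave of the cell on the left is rebased at its right end, where the
    recursion gives it the data \<open>P m\<close> and \<open>D m\<close>.\<close>
  have left: "\<psi> x = free_wave w (a m) (P m) (D m) x" if "a m - l \<le> x" "x < a m" for m x
  proof -
    have e: "\<psi> x = free_wave w (a m - l) (P (m - 1)) (R (m - 1)) x"
      using right[of "m - 1" x] that by (simp add: a1)
    have "P m = free_wave w (a m - l) (P (m - 1)) (R (m - 1)) (a m)"
      "D m = free_wave' w (a m - l) (P (m - 1)) (R (m - 1)) (a m)"
      using step[of "m - 1"] by (simp_all add: free_wave_def free_wave'_def)
    then show ?thesis using free_wave_shift[OF w] e by metis
  qed
  \<comment> \<open>At weight zero \<open>R m\<close> equals \<open>D m\<close>, so the waves on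
    both sides of the lattice point are the same.\<close>
  have whole: "\<psi> x = free_wave w (a m) (P m) (D m) x" if "a m - l < x" "x < a m + l" "v m = 0" for m x
    using left[of m x] right[of m x] that by (cases "x < a m") (auto simp: R_def)
  let ?D = "\<lambda>y. vector_derivative \<psi> (at y)"
  have ev: "eventually (\<lambda>x. x \<in> {a m - l<..<a m}) (at_left (a m))"
    "eventually (\<lambda>x. x \<in> {a m<..<a m + l}) (at_right (a m))" for m
    using l eventually_at_left_real[of "a m - l" "a m"] eventually_at_right_real[of "a m" "a m + l"] by auto
  have dl: "(?D \<longlongrightarrow> D m) (at_left (a m))" for m
  proof (rule Lim_transform_eventually[OF tendsto_free_wave(2)[OF w, of "a m" "P m" "D m" "a m", simplified]])
    have "free_wave' w (a m) (P m) (D m) x = ?D x" if "x \<in> {a m - l<..<a m}" for x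
      by (rule free_wave_eq_on_open(2)[OF w _ that left, symmetric]) auto
    with ev(1)[of m] show "\<forall>\<^sub>F x in at_left (a m). free_wave' w (a m) (P m) (D m) x = ?D x"
      by (auto elim: eventually_mono)
  qed
  have dr: "(?D \<longlongrightarrow> R m) (at_right (a m))" for m
  proof (rule Lim_transform_eventually[OF tendsto_free_wave(2)[OF w, of "a m" "P m" "R m" "a m", simplified]])
    have "free_wave' w (a m) (P m) (R m) x = ?D x" if "x \<in> {a m<..<a m + l}" for x
      by (rule free_wave_eq_on_open(2)[OF w _ that right, symmetric]) auto
    with ev(2)[of m] show "\<forall>\<^sub>F x in at_right (a m). free_wave' w (a m) (P m) (R m) x = ?D x"
      by (auto elim: eventually_mono)
  qed
  have at_a: "\<psi> (a m) = P m" for m using right[of m "a m"] l by simp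
  have cont_a: "isCont \<psi> (a m)" for m
    unfolding isCont_def filterlim_at_split at_a
  proof
    show "(\<psi> \<longlongrightarrow> P m) (at_left (a m))"
      by (rule Lim_transform_eventually[OF tendsto_free_wave(1)[OF w, of "a m" "P m" "D m" "a m", simplified]])
        (rule eventually_mono[OF ev(1)], simp add: left[of m])
    show "(\<psi> \<longlongrightarrow> P m) (at_right (a m))"
      by (rule Lim_transform_eventually[OF tendsto_free_wave(1)[OF w, of "a m" "P m" "R m" "a m", simplified]])
        (rule eventually_mono[OF ev(2)], simp add: right[of m])
  qed
  \<comment> \<open>Off the support a single free wave describes \<open>\<psi>\<close> near
    \<open>x\<close>: on the two adjacent cells if \<open>x\<close> is a lattice point, on the open
    cell around \<open>x\<close> otherwise.\<close>
  have loc: "\<exists>S c p' d'. open S \<and> x \<in> S \<and> (\<forall>y\<in>S. \<psi> y = free_wave w c p' d' y)"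
    if "\<forall>m. x = a m \<longrightarrow> v m = 0" for x
  proof -
    define m where "m = \<lfloor>x / l\<rfloor>"
    have m: "a m \<le> x" "x < a m + l"
      using floor_divide_lower[OF l, of x] floor_divide_upper[OF l, of x]
      by (auto simp: m_def a_def algebra_simps)
    show ?thesis
    proof (cases "x = a m")
      case True
      then have "\<forall>y\<in>{a m - l<..<a m + l}. \<psi> y = free_wave w (a m) (P m) (D m) y"
        using whole that by simp
      then show ?thesis using True l
        by (intro exI[of _ "{a m - l<..<a m + l}"] exI[of _ "a m"] exI[of _ "P m"] exI[of _ "D m"]) auto
    next
      case False
      then have "\<forall>y\<in>{a m<..<a m + l}. \<psi> y = free_wave w (a m) (P m) (R m) y"
        using right by simp
      then show ?thesis using m False
        by (intro exI[of _ "{a m<..<a m + l}"] exI[of _ "a m"] exI[of _ "P m"] exI[of _ "R m"]) auto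
    qed
  qed
  have qa: "q x = 0 \<Longrightarrow> \<forall>m. x = a m \<longrightarrow> v m = 0" for x by (auto simp: v_def a_def)
  have free: "\<psi> differentiable (at x) \<and> (?D has_vector_derivative - (w\<^sup>2 *\<^sub>R \<psi> x)) (at x)" if "q x = 0" for x
    using loc[OF qa[OF that]] free_wave_eq_on_open[OF w] by metis
  have "schroedinger_solution q (w\<^sup>2) \<psi>"
    unfolding schroedinger_solution_def
  proof (intro conjI allI impI)
    show "continuous_on UNIV \<psi>"
    proof (rule continuous_at_imp_continuous_on, rule ballI)
      fix x
      show "isCont \<psi> x"
      proof (cases "q x = 0")
        case True
        then show ?thesis using free by (intro differentiable_imp_continuous_within) auto
      next
        case False
        then show ?thesis using q[OF False] cont_a by (auto simp: a_def)
      qed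
    qed
    fix x
    assume "q x \<noteq> 0"
    then obtain m where m: "x = a m" using q[of x] by (auto simp: a_def)
    have "R m - D m = q x *\<^sub>R \<psi> x" by (simp add: R_def at_a m) (simp add: v_def a_def)
    then show "\<exists>dl dr. (?D \<longlongrightarrow> dl) (at_left x) \<and> (?D \<longlongrightarrow> dr) (at_right x) \<and> dr - dl = q x *\<^sub>R \<psi> x"
      using dl[of m] dr[of m] m by blast
  qed (use free in auto)
  moreover have "\<psi> 0 = p" using at_a[of 0] u0 by (simp add: a_def P_def)
  moreover have "left_deriv \<psi> 0 = d"
    using dl[of 0, THEN left_deriv_eqI] u0 by (simp add: a_def D_def)
  ultimately show ?thesis using that by blast
qed

subsection \<open>The transfer matrix of one period\<close>

text \<open>
  Entries of the transfer matrix over one period from \<open>0-\<close> to \<open>2 l-\<close> in the coordinates \<open>(\<psi>, \<psi>' / w)\<close>,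
  with \<open>b = A / w\<close> and \<open>\<theta> = w l\<close>: the product of rotation by \<open>\<theta>\<close>, the shear by \<open>b\<close>, rotation by \<open>\<theta>\<close>, and
  the shear by \<open>-b\<close>.
\<close>

definition tm11 :: "real \<Rightarrow> real \<Rightarrow> real" where
  "tm11 b \<theta> = (cos \<theta>)\<^sup>2 - (b * sin \<theta>)\<^sup>2 - (sin \<theta>)\<^sup>2 - b * sin \<theta> * cos \<theta>"
definition tm12 :: "real \<Rightarrow> real \<Rightarrow> real" where
  "tm12 b \<theta> = 2 * sin \<theta> * cos \<theta> + b * (sin \<theta>)\<^sup>2"
definition tm21 :: "real \<Rightarrow> real \<Rightarrow> real" where
  "tm21 b \<theta> = b * (sin \<theta>)\<^sup>2 - 2 * sin \<theta> * cos \<theta> - b\<^sup>2 * sin \<theta> * cos \<theta>"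
definition tm22 :: "real \<Rightarrow> real \<Rightarrow> real" where
  "tm22 b \<theta> = (cos \<theta>)\<^sup>2 - (sin \<theta>)\<^sup>2 + b * sin \<theta> * cos \<theta>"

text \<open>This is \<open>F(\<omega>)\<close> in the variables \<open>b = A / \<omega>\<close> and
  \<open>\<theta> = \<omega> l\<close>.\<close>

definition tm_half_trace :: "real \<Rightarrow> real \<Rightarrow> real" where
  "tm_half_trace b \<theta> = cos (2 * \<theta>) - b\<^sup>2 / 2 * (sin \<theta>)\<^sup>2"

lemma tm_trace: "tm11 b \<theta> + tm22 b \<theta> = 2 * tm_half_trace b \<theta>"
  unfolding tm11_def tm22_def tm_half_trace_def cos_double by (simp add: algebra_simps)

text \<open>Rotations and shears have determinant one; expanded, the product of the four
  determinants is the square of \<open>sin\<^sup>2 + cos\<^sup>2\<close>.\<close>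

lemma tm_det: "tm11 b \<theta> * tm22 b \<theta> - tm12 b \<theta> * tm21 b \<theta> = 1"
proof -
  have "tm11 b \<theta> * tm22 b \<theta> - tm12 b \<theta> * tm21 b \<theta> = ((sin \<theta>)\<^sup>2 + (cos \<theta>)\<^sup>2)\<^sup>2"
    unfolding tm11_def tm12_def tm21_def tm22_def by algebra
  then show ?thesis by simp
qed

text \<open>
  For a matrix of determinant \<open>1\<close> this is the squared Frobenius norm minus \<open>2\<close>. In this form it
  ignores multiples of the identity, so for \<open>M ^ N\<close> it is just scaled by a squared Chebyshev coefficient.
\<close>

lemma tm_anisotropy:
  "(tm11 b \<theta> - tm22 b \<theta>)\<^sup>2 + (tm12 b \<theta> + tm21 b \<theta>)\<^sup>2 = b\<^sup>2 * ((sin \<theta>)\<^sup>2 * (4 + b\<^sup>2))"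
proof -
  have "(tm11 b \<theta> - tm22 b \<theta>)\<^sup>2 + (tm12 b \<theta> + tm21 b \<theta>)\<^sup>2
      = b\<^sup>2 * ((sin \<theta>)\<^sup>2 * (4 + b\<^sup>2)) * ((sin \<theta>)\<^sup>2 + (cos \<theta>)\<^sup>2)"
    unfolding tm11_def tm12_def tm21_def tm22_def by algebra
  then show ?thesis by simp
qed

text \<open>With \<open>y = (sin \<theta>)\<^sup>2 * (4 + b\<^sup>2) / 4\<close> the half-trace is
  \<open>1 - 2 * y\<close>, and \<open>1 - (1 - 2 * y)\<^sup>2 = 4 * y * (1 - y)\<close>.\<close>

lemma one_minus_tm_half_trace_square:
  "1 - (tm_half_trace b \<theta>)\<^sup>2 = (sin \<theta>)\<^sup>2 * (4 + b\<^sup>2) * (1 - (sin \<theta>)\<^sup>2 * (4 + b\<^sup>2) / 4)"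
  unfolding tm_half_trace_def cos_double_sin by (simp add: field_simps power2_eq_square)

lemma solution_period:
  fixes \<psi> :: "real \<Rightarrow> 'a::real_normed_vector"
  assumes sol: "schroedinger_solution q (w\<^sup>2) \<psi>" and w: "w \<noteq> 0" and l: "l > 0"
    and q: "q a = - A" "q (a + l) = A"
      "\<And>x. a < x \<Longrightarrow> x < a + l \<Longrightarrow> q x = 0" "\<And>x. a + l < x \<Longrightarrow> x < a + 2 * l \<Longrightarrow> q x = 0"
  shows "\<psi> (a + 2 * l) = tm11 (A / w) (w * l) *\<^sub>R \<psi> a + (tm12 (A / w) (w * l) / w) *\<^sub>R left_deriv \<psi> a"
    and "left_deriv \<psi> (a + 2 * l) = (w * tm21 (A / w) (w * l)) *\<^sub>R \<psi> a + tm22 (A / w) (w * l) *\<^sub>R left_deriv \<psi> a"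
proof -
  define b c s where "b = A / w" and "c = cos (w * l)" and "s = sin (w * l)"
  have A: "A = b * w" using w by (simp add: b_def)
  \<comment> \<open>A half-period is a jump of weight \<open>v\<close> at its left end followed by
    free flow over \<open>l\<close>; the period composes \<open>v = - A\<close> with
    \<open>v = A\<close>.\<close>
  have half: "\<psi> (x + l) = (c + s * v / w) *\<^sub>R \<psi> x + (s / w) *\<^sub>R left_deriv \<psi> x"
    "left_deriv \<psi> (x + l) = (c * v - w * s) *\<^sub>R \<psi> x + c *\<^sub>R left_deriv \<psi> x"
    if "q x = v" and zero: "\<forall>y\<in>{x<..<x + l}. q y = 0" for x v
  proof -
    have "x < x + l" using l by simp
    from zero have "\<And>y. x < y \<Longrightarrow> y < x + l \<Longrightarrow> q y = 0" by simp
    note * = solution_right_of[OF sol w \<open>x < x + l\<close> this, simplified \<open>q x = v\<close>]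
    show "\<psi> (x + l) = (c + s * v / w) *\<^sub>R \<psi> x + (s / w) *\<^sub>R left_deriv \<psi> x"
      using *(1)[of "x + l"] l by (simp add: free_wave_def c_def s_def algebra_simps)
    show "left_deriv \<psi> (x + l) = (c * v - w * s) *\<^sub>R \<psi> x + c *\<^sub>R left_deriv \<psi> x"
      using *(2) by (simp add: free_wave'_def c_def s_def algebra_simps)
  qed
  have e: "a + 2 * l = (a + l) + l" by simp
  have lin: "x *\<^sub>R (x1 *\<^sub>R p + y1 *\<^sub>R d) + y *\<^sub>R (x2 *\<^sub>R p + y2 *\<^sub>R d)
      = (x * x1 + y * x2) *\<^sub>R p + (x * y1 + y * y2) *\<^sub>R d" for x y x1 x2 y1 y2 and p d :: 'a
    by (simp add: algebra_simps)
  have q': "\<forall>y\<in>{a<..<a + l}. q y = 0" "\<forall>y\<in>{a + l<..<a + l + l}. q y = 0"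
    using q(3,4) by simp_all
  note half1 = half[OF q(1) q'(1)] and half2 = half[OF q(2) q'(2)]
  show "\<psi> (a + 2 * l) = tm11 (A / w) (w * l) *\<^sub>R \<psi> a + (tm12 (A / w) (w * l) / w) *\<^sub>R left_deriv \<psi> a"
    unfolding e half2(1) half1 lin using w
    by (intro arg_cong2[where f = "(+)"] arg_cong2[where f = "(*\<^sub>R)"])
      (simp_all add: tm11_def tm12_def b_def[symmetric] c_def[symmetric] s_def[symmetric],
        simp_all add: A field_simps power2_eq_square)
  show "left_deriv \<psi> (a + 2 * l) = (w * tm21 (A / w) (w * l)) *\<^sub>R \<psi> a + tm22 (A / w) (w * l) *\<^sub>R left_deriv \<psi> a"
    unfolding e half2(2) half1 lin using w
    by (intro arg_cong2[where f = "(+)"] arg_cong2[where f = "(*\<^sub>R)"])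
      (simp_all add: tm21_def tm22_def b_def[symmetric] c_def[symmetric] s_def[symmetric],
        simp_all add: A field_simps power2_eq_square)
qed

section \<open>The infinite comb and its half-trace\<close>

lemma not_in_lattice:
  fixes l x :: real and m :: int
  assumes "l > 0" "of_int m * l < x" "x < of_int m * l + l"
  shows "x \<notin> range (\<lambda>m::int. of_int m * l)"
proof
  assume "x \<in> range (\<lambda>m::int. of_int m * l)"
  then obtain k :: int where x: "x = of_int k * l" by auto
  have "of_int m * l < of_int k * l" "of_int k * l < of_int (m + 1) * l"
    using assms x by (simp_all add: algebra_simps)
  then have "m < k" "k < m + 1"
    using \<open>l > 0\<close> by (simp_all only: mult_less_cancel_right_pos of_int_less_iff)
  then show False by simp
qed

lemma dirac_comb_support:
  assumes "dirac_comb l A x \<noteq> 0" shows "x \<in> range (\<lambda>m::int. of_int m * l)"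
proof -
  from assms have "(\<exists>n::int. x = (2 * of_int n + 1) * l) \<or> (\<exists>n::int. x = (2 * of_int n) * l)"
    by (auto simp: dirac_comb_def indicator_def image_iff)
  then have "(\<exists>n::int. x = of_int (2 * n + 1) * l) \<or> (\<exists>n::int. x = of_int (2 * n) * l)" by simp
  then show ?thesis by blast
qed

lemma dirac_comb_at:
  assumes "l > 0"
  shows "dirac_comb l A 0 = - A" "dirac_comb l A l = A"
proof -
  have odd: "2 * real_of_int n + 1 \<noteq> 0" "1 \<noteq> 2 * real_of_int n" for n
  proof -
    have "2 * n + 1 \<noteq> 0" "1 \<noteq> 2 * n" by presburger+
    then show "2 * real_of_int n + 1 \<noteq> 0" "1 \<noteq> 2 * real_of_int n" by linarith+
  qed
  have "0 \<notin> range (\<lambda>n::int. (2 * of_int n + 1) * l)" "l \<notin> range (\<lambda>n::int. 2 * of_int n * l)"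
    using odd assms by auto
  moreover have "0 \<in> range (\<lambda>n::int. 2 * of_int n * l)" "l \<in> range (\<lambda>n::int. (2 * of_int n + 1) * l)"
    by (rule range_eqI[of _ _ 0], simp)+
  ultimately show "dirac_comb l A 0 = - A" "dirac_comb l A l = A"
    by (simp_all add: dirac_comb_def)
qed

lemma half_trace_eq:
  assumes l: "l > 0" and w: "w \<noteq> 0"
  shows "half_trace l A w = tm_half_trace (A / w) (w * l)"
proof -
  let ?q = "dirac_comb l A"
  \<comment> \<open>The transfer matrix in the original coordinates
    \<open>(\<psi>, \<psi>')\<close>: conjugation by the diagonal matrix with entries
    \<open>1\<close> and \<open>w\<close>, which keeps the trace.\<close>
  define M :: "real ^ 2 ^ 2" where
    "M = vector [vector [tm11 (A / w) (w * l), tm12 (A / w) (w * l) / w],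
      vector [w * tm21 (A / w) (w * l), tm22 (A / w) (w * l)]]"
  have zero: "?q x = 0" if "real_of_int m * l < x" "x < of_int m * l + l" for m x
    using dirac_comb_support not_in_lattice[OF l that] by blast
  have M: "left_data \<psi> (2 * l) = M *v left_data \<psi> 0" if "schroedinger_solution ?q (w\<^sup>2) \<psi>" for \<psi>
    using solution_period[OF that w l, of 0 A] dirac_comb_at[OF l, of A] zero[of 0] zero[of 1]
    by (simp add: left_data_eq vec_eq_iff forall_2 matrix_vector_mult_def sum_2 M_def)
  have "monodromy_matrix ?q (w\<^sup>2) 0 (2 * l) = M"
    unfolding monodromy_matrix_def
  proof (rule the_equality)
    show "\<forall>\<psi>. schroedinger_solution ?q (w\<^sup>2) \<psi> \<longrightarrow> left_data \<psi> (2 * l) = M *v left_data \<psi> 0"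
      using M by blast
    fix M' assume M': "\<forall>\<psi>. schroedinger_solution ?q (w\<^sup>2) \<psi> \<longrightarrow> left_data \<psi> (2 * l) = M' *v left_data \<psi> 0"
    \<comment> \<open>Uniqueness for the definite description: each vector \<open>y\<close> occurs
      as the left data of some solution at \<open>0\<close>.\<close>
    have "M' *v y = M *v y" for y
    proof -
      obtain \<psi> where \<psi>: "schroedinger_solution ?q (w\<^sup>2) \<psi>" "\<psi> 0 = y $ 1" "left_deriv \<psi> 0 = y $ 2"
        using lattice_solution_exists[OF l w, of ?q "y $ 1" "y $ 2"] dirac_comb_support by metis
      then have "left_data \<psi> 0 = y" by (simp add: left_data_eq vec_eq_iff forall_2)
      then show ?thesis using M[OF \<psi>(1)] M' \<psi>(1) by metis
    qed
    then show "M' = M" by (simp add: matrix_eq)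
  qed
  then show ?thesis
    using tm_trace[of "A / w" "w * l"] by (simp add: half_trace_def trace_def sum_2 M_def)
qed

subsection \<open>Chebyshev polynomials and powers of the transfer matrix\<close>

text \<open>The index is shifted: \<open>cheb n\<close> is the Chebyshev polynomial of the second kind of degree \<open>n - 1\<close>.\<close>

fun cheb :: "nat \<Rightarrow> 'a::comm_ring_1 \<Rightarrow> 'a" where
  "cheb 0 x = 0"
| "cheb (Suc 0) x = 1"
| "cheb (Suc (Suc n)) x = 2 * x * cheb (Suc n) x - cheb n x"

lemma cheb_of_real: "cheb n (of_real x) = (of_real (cheb n x) :: 'a::{real_algebra_1,comm_ring_1})"
  by (induction n x rule: cheb.induct) simp_all

text \<open>The Chebyshev recursion is the sum formula for
  \<open>sin (m z + z) + sin (m z - z)\<close>. The argument is complex because \<open>F\<close> may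
  lie outside \<open>[-1, 1]\<close>, and without a quotient the identity also covers
  \<open>sin z = 0\<close>.\<close>

lemma sin_nat_mult: "sin (of_nat n * z) = cheb n (cos z) * sin (z::complex)"
proof (induction n "z" rule: cheb.induct)
  case (3 n z)
  have "sin (of_nat (Suc n) * z + z) + sin (of_nat (Suc n) * z - z) = 2 * cos z * sin (of_nat (Suc n) * z)"
    by (simp only: sin_add sin_diff) simp
  moreover have "of_nat (Suc n) * z + z = of_nat (Suc (Suc n)) * z" "of_nat (Suc n) * z - z = of_nat n * z"
    by (simp_all add: algebra_simps)
  ultimately have "sin (of_nat (Suc (Suc n)) * z) = 2 * cos z * sin (of_nat (Suc n) * z) - sin (of_nat n * z)"
    by (metis add_diff_cancel_right')
  then show ?case by (simp only: 3 cheb.simps) (simp add: algebra_simps)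
qed auto

text \<open>The quadratic form is invariant under the recursion step from \<open>(u, v)\<close> to
  \<open>(2 * x * u - v, u)\<close>. It is the determinant of the iterated transfer matrix.\<close>

lemma cheb_quadratic: "(cheb (Suc n) x)\<^sup>2 - 2 * x * cheb (Suc n) x * cheb n x + (cheb n x)\<^sup>2 = 1"
  by (induction n) (simp_all add: algebra_simps power2_eq_square)

text \<open>By Cayley-Hamilton \<open>M\<^sup>2 = 2 f M - 1\<close>, so the power with exponent
  \<open>Suc j\<close> is \<open>cheb (Suc j) f\<close> times \<open>M\<close> minus
  \<open>cheb j f\<close> times the identity.\<close>

lemma matrix_iterates_cheb:
  fixes x y :: "nat \<Rightarrow> 'a::real_vector"
  assumes tr: "m11 + m22 = 2 * f" and det: "m11 * m22 - m12 * m21 = 1"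
    and x: "\<And>j. j < N \<Longrightarrow> x (Suc j) = m11 *\<^sub>R x j + m12 *\<^sub>R y j"
    and y: "\<And>j. j < N \<Longrightarrow> y (Suc j) = m21 *\<^sub>R x j + m22 *\<^sub>R y j"
    and j: "Suc j \<le> N"
  shows "x (Suc j) = (cheb (Suc j) f * m11 - cheb j f) *\<^sub>R x 0 + (cheb (Suc j) f * m12) *\<^sub>R y 0"
    and "y (Suc j) = (cheb (Suc j) f * m21) *\<^sub>R x 0 + (cheb (Suc j) f * m22 - cheb j f) *\<^sub>R y 0"
proof -
  have "x (Suc j) = (cheb (Suc j) f * m11 - cheb j f) *\<^sub>R x 0 + (cheb (Suc j) f * m12) *\<^sub>R y 0 \<and>
    y (Suc j) = (cheb (Suc j) f * m21) *\<^sub>R x 0 + (cheb (Suc j) f * m22 - cheb j f) *\<^sub>R y 0"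
    using j
  proof (induction j)
    case 0
    then show ?case using x[of 0] y[of 0] by simp
  next
    case (Suc j)
    let ?a = "cheb (Suc j) f" and ?b = "cheb j f"
    have IH: "x (Suc j) = (?a * m11 - ?b) *\<^sub>R x 0 + (?a * m12) *\<^sub>R y 0"
      "y (Suc j) = (?a * m21) *\<^sub>R x 0 + (?a * m22 - ?b) *\<^sub>R y 0"
      using Suc by simp_all
    have lin: "u *\<^sub>R (x1 *\<^sub>R p + y1 *\<^sub>R d) + v *\<^sub>R (x2 *\<^sub>R p + y2 *\<^sub>R d)
      = (u * x1 + v * x2) *\<^sub>R p + (u * y1 + v * y2) *\<^sub>R d" for u v x1 x2 y1 y2 and p d :: 'a
      by (simp add: algebra_simps)
    \<comment> \<open>The four entries of
      \<open>M (?a M - ?b) = (2 f ?a - ?b) M - ?a\<close>.\<close>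
    have "m11 * (?a * m11 - ?b) + m12 * (?a * m21) = (2 * f * ?a - ?b) * m11 - ?a"
      "m11 * (?a * m12) + m12 * (?a * m22 - ?b) = (2 * f * ?a - ?b) * m12"
      "m21 * (?a * m11 - ?b) + m22 * (?a * m21) = (2 * f * ?a - ?b) * m21"
      "m21 * (?a * m12) + m22 * (?a * m22 - ?b) = (2 * f * ?a - ?b) * m22 - ?a"
      using tr det by algebra+
    then show ?case
      using x[of "Suc j"] y[of "Suc j"] Suc.prems by (simp add: IH lin)
  qed
  then show "x (Suc j) = (cheb (Suc j) f * m11 - cheb j f) *\<^sub>R x 0 + (cheb (Suc j) f * m12) *\<^sub>R y 0"
    and "y (Suc j) = (cheb (Suc j) f * m21) *\<^sub>R x 0 + (cheb (Suc j) f * m22 - cheb j f) *\<^sub>R y 0"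
    by auto
qed

subsection \<open>The scattering problem\<close>

lemma truncated_comb_nonzero:
  assumes "truncated_comb l A N x \<noteq> 0"
  obtains m :: nat where "m < 2 * N" "x = real m * l"
proof -
  from assms have "(\<Sum>n<N. indicator {(2 * real n + 1) * l} x - indicator {2 * real n * l} x) \<noteq> (0::real)"
    by (auto simp only: truncated_comb_def)
  then obtain n where n: "n < N"
      "indicator {(2 * real n + 1) * l} x - indicator {2 * real n * l} x \<noteq> (0::real)"
    by (rule sum.not_neutral_contains_not_neutral) auto
  then have "x = (2 * real n + 1) * l \<or> x = 2 * real n * l"
    by (cases "x = (2 * real n + 1) * l"; cases "x = 2 * real n * l") simp_all
  then show ?thesis
  proof
    assume "x = (2 * real n + 1) * l"
    then show ?thesis using n(1) by (intro that[of "2 * n + 1"]) auto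
  next
    assume "x = 2 * real n * l"
    then show ?thesis using n(1) by (intro that[of "2 * n"]) auto
  qed
qed

lemma truncated_comb_support:
  assumes "truncated_comb l A N x \<noteq> 0"
  shows "x \<in> range (\<lambda>m::int. of_int m * l)"
proof -
  from assms obtain m where "x = real m * l" by (rule truncated_comb_nonzero)
  then show ?thesis by (intro range_eqI[of _ _ "int m"]) simp
qed

text \<open>The last interaction sits at \<open>(2 * N - 1) * l\<close>. Hence the right end of the
  last period already belongs to the free region, and the left data there are those of the outgoing
  wave.\<close>

lemma truncated_comb_outside:
  assumes "l > 0" "x < 0 \<or> real (2 * N) * l \<le> x"
  shows "truncated_comb l A N x = 0"
proof (rule ccontr)
  assume "truncated_comb l A N x \<noteq> 0"
  then obtain m where "m < 2 * N" "x = real m * l" by (rule truncated_comb_nonzero)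
  moreover from this have "real m * l < real (2 * N) * l" "0 \<le> real m * l" using \<open>l > 0\<close> by simp_all
  ultimately show False using assms(2) by linarith
qed

lemma truncated_comb_at:
  assumes l: "l > 0" and j: "j < N"
  shows "truncated_comb l A N (2 * real j * l) = - A"
    and "truncated_comb l A N (2 * real j * l + l) = A"
proof -
  have i: "2 * real n + 1 \<noteq> 2 * real j" "2 * real j + 1 \<noteq> 2 * real n" for n
  proof -
    have "2 * n + 1 \<noteq> 2 * j" "2 * j + 1 \<noteq> 2 * n" by presburger+
    then show "2 * real n + 1 \<noteq> 2 * real j" "2 * real j + 1 \<noteq> 2 * real n" by linarith+
  qed
  have e: "2 * real j * l + l = (2 * real j + 1) * l" by (simp add: algebra_simps)
  \<comment> \<open>By parity the positive and negative interactions never coincide, so only the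
    summand \<open>n = j\<close> survives.\<close>
  have "indicator {(2 * real n + 1) * l} (2 * real j * l) - indicator {2 * real n * l} (2 * real j * l)
      = (if n = j then - 1 else 0 :: real)" for n
    using l i(1)[of n] by (auto simp: indicator_def)
  then have "truncated_comb l A N (2 * real j * l) = A * (\<Sum>n<N. if n = j then - 1 else 0)"
    unfolding truncated_comb_def by (simp only:)
  then show "truncated_comb l A N (2 * real j * l) = - A" using j by simp
  have "indicator {(2 * real n + 1) * l} ((2 * real j + 1) * l) - indicator {2 * real n * l} ((2 * real j + 1) * l)
      = (if n = j then 1 else 0 :: real)" for n
    using l i(2)[of n] by (auto simp: indicator_def)
  then have "truncated_comb l A N (2 * real j * l + l) = A * (\<Sum>n<N. if n = j then 1 else 0)"
    unfolding truncated_comb_def e by (simp only:)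
  then show "truncated_comb l A N (2 * real j * l + l) = A" using j by simp
qed

lemma truncated_comb_between:
  assumes "l > 0" "real m * l < x" "x < real m * l + l"
  shows "truncated_comb l A N x = 0"
  using not_in_lattice[of l "int m" x] truncated_comb_support[of l A N x] assms by auto

section \<open>Plane waves and their Cauchy data\<close>

lemma free_wave_plane_wave:
  assumes "w \<noteq> 0"
  shows "free_wave w a (z * exp (\<i> * of_real (w * a))) (\<i> * of_real w * (z * exp (\<i> * of_real (w * a)))) x
      = z * exp (\<i> * of_real (w * x))"
proof -
  have "exp (\<i> * of_real (w * x)) = exp (\<i> * of_real (w * a)) * exp (\<i> * of_real (w * (x - a)))"
    by (simp add: exp_add[symmetric] algebra_simps)
  also have "exp (\<i> * of_real (w * (x - a))) = of_real (cos (w * (x - a))) + \<i> * of_real (sin (w * (x - a)))"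
    by (simp add: exp_Euler cos_of_real sin_of_real del: of_real_mult of_real_diff)
  finally show ?thesis using assms
    by (simp add: free_wave_def scaleR_conv_of_real algebra_simps del: of_real_mult of_real_diff)
qed

lemma free_wave_incident:
  assumes "w \<noteq> 0"
  shows "free_wave w 0 (1 + r) (\<i> * of_real w * (1 - r)) x
      = exp (\<i> * of_real (w * x)) + r * exp (- \<i> * of_real (w * x))"
proof -
  have "exp (- \<i> * of_real (w * x)) = exp (\<i> * of_real (- (w * x)))" by simp
  then have e: "exp (\<i> * of_real (w * x)) = of_real (cos (w * x)) + \<i> * of_real (sin (w * x))"
    "exp (- \<i> * of_real (w * x)) = of_real (cos (w * x)) - \<i> * of_real (sin (w * x))"
    by (simp_all only: exp_Euler cos_of_real sin_of_real) simp_all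
  show ?thesis unfolding e using assms
    by (simp add: free_wave_def scaleR_conv_of_real algebra_simps)
qed

text \<open>A full wavelength away from \<open>a\<close> the wave has the value \<open>p\<close>
  again; a quarter wavelength away the cosine vanishes and only the \<open>d\<close> term is left.
  The sign \<open>\<epsilon>\<close> selects the half-line.\<close>

lemma free_wave_inject:
  assumes "w > 0" and "\<epsilon> = 1 \<or> \<epsilon> = - 1"
    and eq: "\<And>x. \<epsilon> * (x - a) > 0 \<Longrightarrow> free_wave w a p d x = free_wave w a p' d' x"
  shows "p = p'" "d = d'"
proof -
  have \<epsilon>: "\<epsilon> * (\<epsilon> * z) = z" for z using assms(2) by auto
  have "free_wave w a p d (a + \<epsilon> * (2 * pi / w)) = free_wave w a p' d' (a + \<epsilon> * (2 * pi / w))"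
    by (rule eq) (use \<open>w > 0\<close> in \<open>simp add: \<epsilon>\<close>)
  then show "p = p'" using assms(1,2) by (auto simp: free_wave_def)
  moreover have "free_wave w a p d (a + \<epsilon> * (pi / 2 / w)) = free_wave w a p' d' (a + \<epsilon> * (pi / 2 / w))"
    by (rule eq) (use \<open>w > 0\<close> in \<open>simp add: \<epsilon>\<close>)
  ultimately show "d = d'" using assms(1,2) by (auto simp: free_wave_def)
qed

text \<open>On each free half-line a solution is determined by its Cauchy data, so the two
  scattering conditions become four equations at \<open>0-\<close> and at the end \<open>c\<close>
  of the last period.\<close>

lemma scattering_solution_iff:
  fixes l A w :: real and N :: nat
  defines "c \<equiv> real (2 * N) * l"
  assumes l: "l > 0" and w: "w > 0"
  shows "scattering_solution l A N w \<psi> r t \<longleftrightarrow>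
    schroedinger_solution (truncated_comb l A N) (w\<^sup>2) \<psi> \<and>
    \<psi> 0 = 1 + r \<and> left_deriv \<psi> 0 = \<i> * of_real w * (1 - r) \<and>
    \<psi> c = t * exp (\<i> * of_real (w * c)) \<and>
    left_deriv \<psi> c = \<i> * of_real w * (t * exp (\<i> * of_real (w * c)))"
proof -
  have c: "real N * (2 * l) = c" by (simp add: c_def)
  have w0: "w \<noteq> 0" using w by simp
  show ?thesis
  proof (cases "schroedinger_solution (truncated_comb l A N) (w\<^sup>2) \<psi>")
    case True
    have L: "\<psi> x = free_wave w 0 (\<psi> 0) (left_deriv \<psi> 0) x" if "x < 0" for x
      by (rule solution_left_of[OF True w0]) (use that l truncated_comb_outside in auto)
    have R: "\<psi> x = free_wave w c (\<psi> c) (left_deriv \<psi> c) x" if "x > c" for x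
    proof -
      have "truncated_comb l A N y = 0" if "c \<le> y" for y
        using truncated_comb_outside[OF l] that by (simp add: c_def)
      then show ?thesis
        using solution_right_of(1)[OF True w0 that, of x] that by simp
    qed
    have "(\<forall>x<0. \<psi> x = exp (\<i> * of_real (w * x)) + r * exp (- \<i> * of_real (w * x))) \<longleftrightarrow>
        \<psi> 0 = 1 + r \<and> left_deriv \<psi> 0 = \<i> * of_real w * (1 - r)"
      (is "_ \<longleftrightarrow> _ = ?p \<and> _ = ?d")
      unfolding free_wave_incident[OF w0, symmetric]
    proof
      assume "\<forall>x<0. \<psi> x = free_wave w 0 ?p ?d x"
      then have *: "free_wave w 0 (\<psi> 0) (left_deriv \<psi> 0) x = free_wave w 0 ?p ?d x" if "- 1 * (x - 0) > 0" for x
        using that L[of x] by simp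
      have "\<psi> 0 = ?p" "left_deriv \<psi> 0 = ?d"
        by (rule free_wave_inject[OF w disjI2[OF refl] *]; assumption)+
      then show "\<psi> 0 = ?p \<and> left_deriv \<psi> 0 = ?d" ..
    qed (use L in simp)
    moreover have "(\<forall>x>c. \<psi> x = t * exp (\<i> * of_real (w * x))) \<longleftrightarrow>
        \<psi> c = t * exp (\<i> * of_real (w * c)) \<and>
        left_deriv \<psi> c = \<i> * of_real w * (t * exp (\<i> * of_real (w * c)))"
      (is "_ \<longleftrightarrow> _ = ?p \<and> _ = ?d")
    proof
      assume "\<forall>x>c. \<psi> x = t * exp (\<i> * of_real (w * x))"
      then have *: "free_wave w c (\<psi> c) (left_deriv \<psi> c) x = free_wave w c ?p ?d x" if "1 * (x - c) > 0" for x
        using that R[of x] free_wave_plane_wave[OF w0, of c t x] by simp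
      have "\<psi> c = ?p" "left_deriv \<psi> c = ?d"
        by (rule free_wave_inject[OF w disjI1[OF refl] *]; assumption)+
      then show "\<psi> c = ?p \<and> left_deriv \<psi> c = ?d" ..
    next
      assume "\<psi> c = ?p \<and> left_deriv \<psi> c = ?d"
      then have "\<psi> x = free_wave w c ?p ?d x" if "x > c" for x
        using R[OF that] by (simp only:)
      then show "\<forall>x>c. \<psi> x = t * exp (\<i> * of_real (w * x))"
        unfolding free_wave_plane_wave[OF w0] by blast
    qed
    ultimately show ?thesis using True by (simp add: scattering_solution_def c)
  qed (simp add: scattering_solution_def)
qed

text \<open>Inverting the matrix of determinant one gives \<open>1 + r = \<tau> (d - \<i> b)\<close>
  and \<open>1 - r = \<tau> (a + \<i> c)\<close>, whose sum is \<open>\<tau> D = 2\<close>. The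
  determinant also turns \<open>|D|\<^sup>2 = (a + d)\<^sup>2 + (c - b)\<^sup>2\<close> into the
  denominator in the second claim, so \<open>D\<close> is nonzero.\<close>

lemma scattering_linear_system:
  fixes a b c d :: real and r \<tau> :: complex
  assumes det: "a * d - b * c = 1"
  defines "D \<equiv> Complex (a + d) (c - b)"
  shows "of_real a * (1 + r) + of_real b * (\<i> * (1 - r)) = \<tau> \<and>
      of_real c * (1 + r) + of_real d * (\<i> * (1 - r)) = \<i> * \<tau> \<longleftrightarrow>
      \<tau> = 2 / D \<and> r = \<tau> * Complex d (- b) - 1"
    and "(cmod (2 / D))\<^sup>2 = 4 / ((a - d)\<^sup>2 + (b + c)\<^sup>2 + 4)"
proof -
  have *: "(a + d)\<^sup>2 + (c - b)\<^sup>2 = (a - d)\<^sup>2 + (b + c)\<^sup>2 + 4"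
    using det by algebra
  have "(cmod D)\<^sup>2 = (a - d)\<^sup>2 + (b + c)\<^sup>2 + 4"
    unfolding *[symmetric] by (simp add: D_def cmod_power2)
  then show "(cmod (2 / D))\<^sup>2 = 4 / ((a - d)\<^sup>2 + (b + c)\<^sup>2 + 4)"
    by (simp add: norm_divide power_divide)
  have "(cmod D)\<^sup>2 > 0" unfolding \<open>(cmod D)\<^sup>2 = _\<close> by (simp add: add_nonneg_pos)
  then have D0: "D \<noteq> 0" by auto
  have D: "D = of_real a + of_real d + \<i> * (of_real c - of_real b)"
    and db: "Complex d (- b) = of_real d - \<i> * of_real b"
    by (simp_all add: D_def complex_eq_iff)
  have det': "(of_real a * of_real d - of_real b * of_real c :: complex) = 1"
    using det by (metis of_real_1 of_real_diff of_real_mult)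
  have t: "\<tau> = 2 / D \<longleftrightarrow> \<tau> * D = 2" using D0 by (simp add: field_simps)
  show "of_real a * (1 + r) + of_real b * (\<i> * (1 - r)) = \<tau> \<and>
      of_real c * (1 + r) + of_real d * (\<i> * (1 - r)) = \<i> * \<tau> \<longleftrightarrow>
      \<tau> = 2 / D \<and> r = \<tau> * Complex d (- b) - 1" (is "?E1 \<and> ?E2 \<longleftrightarrow> ?T \<and> ?R")
  proof
    assume "?E1 \<and> ?E2"
    then have 1: ?E1 and 2: ?E2 by simp_all
    have inv: "X = of_real d * U - of_real b * V" "Y = of_real a * V - of_real c * U"
      if "of_real a * X + of_real b * Y = U" "of_real c * X + of_real d * Y = V" for X Y U V :: complex
    proof -
      have "X = (of_real a * of_real d - of_real b * of_real c) * X" using det' by simp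
      also have "\<dots> = of_real d * U - of_real b * V" unfolding that[symmetric] by (simp add: algebra_simps)
      finally show "X = of_real d * U - of_real b * V" .
      have "Y = (of_real a * of_real d - of_real b * of_real c) * Y" using det' by simp
      also have "\<dots> = of_real a * V - of_real c * U" unfolding that[symmetric] by (simp add: algebra_simps)
      finally show "Y = of_real a * V - of_real c * U" .
    qed
    have p: "1 + r = \<tau> * (of_real d - \<i> * of_real b)" using inv(1)[OF 1 2] by (simp add: algebra_simps)
    have "1 - r = - \<i> * (\<i> * (1 - r))" by simp
    also have "\<dots> = \<tau> * (of_real a + \<i> * of_real c)" unfolding inv(2)[OF 1 2] by (simp add: algebra_simps)
    finally have m: "1 - r = \<tau> * (of_real a + \<i> * of_real c)" .
    from p have ?R unfolding db by algebra
    moreover from p m have ?T unfolding t unfolding D by algebra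
    ultimately show "?T \<and> ?R" by blast
  next
    assume *: "?T \<and> ?R"
    then have 1: "\<tau> * (of_real a + of_real d + \<i> * (of_real c - of_real b)) = 2"
      unfolding t unfolding D by (rule conjunct1)
    from * have 2: "r = \<tau> * (of_real d - \<i> * of_real b) - 1" unfolding db by (rule conjunct2)
    have p: "1 + r = \<tau> * (of_real d - \<i> * of_real b)" using 2 by algebra
    have m: "1 - r = \<tau> * (of_real a + \<i> * of_real c)" using 1 unfolding 2 by (simp add: algebra_simps)
    have "\<i> * (1 - r) = \<i> * \<tau> * of_real a - \<tau> * of_real c" unfolding m by (simp add: algebra_simps)
    note X = p this
    have ?E1 unfolding X using arg_cong[OF det', of "(*) \<tau>"] by (simp add: algebra_simps)
    moreover have ?E2 unfolding X using arg_cong[OF det', of "(*) (\<i> * \<tau>)"] by (simp add: algebra_simps)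
    ultimately show "?E1 \<and> ?E2" ..
  qed
qed

section \<open>Transmission through \<open>N\<close> periods\<close>

lemma solution_truncated_comb:
  assumes sol: "schroedinger_solution (truncated_comb l A N) (w\<^sup>2) \<psi>" and l: "l > 0" and w: "w \<noteq> 0"
    and N: "N = Suc j"
  defines "b \<equiv> A / w" and "\<theta> \<equiv> w * l" and "c \<equiv> real (2 * N) * l"
  defines "f \<equiv> tm_half_trace b \<theta>"
  shows "\<psi> c = (cheb N f * tm11 b \<theta> - cheb j f) *\<^sub>R \<psi> 0
      + (cheb N f * (tm12 b \<theta> / w)) *\<^sub>R left_deriv \<psi> 0" (is ?thesis1)
    and "left_deriv \<psi> c = (cheb N f * (w * tm21 b \<theta>)) *\<^sub>R \<psi> 0
      + (cheb N f * tm22 b \<theta> - cheb j f) *\<^sub>R left_deriv \<psi> 0" (is ?thesis2)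
proof -
  define a where "a = (\<lambda>j. 2 * real j * l)"
  have step: "\<psi> (a (Suc j)) = tm11 b \<theta> *\<^sub>R \<psi> (a j) + (tm12 b \<theta> / w) *\<^sub>R left_deriv \<psi> (a j)"
    "left_deriv \<psi> (a (Suc j)) = (w * tm21 b \<theta>) *\<^sub>R \<psi> (a j) + tm22 b \<theta> *\<^sub>R left_deriv \<psi> (a j)"
    if "j < N" for j
  proof -
    have z: "\<And>x. a j < x \<Longrightarrow> x < a j + l \<Longrightarrow> truncated_comb l A N x = 0"
      "\<And>x. a j + l < x \<Longrightarrow> x < a j + 2 * l \<Longrightarrow> truncated_comb l A N x = 0"
      using truncated_comb_between[OF l, of "2 * j"] truncated_comb_between[OF l, of "2 * j + 1"]
      by (auto simp: a_def algebra_simps)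
    have e: "a (Suc j) = a j + 2 * l" by (simp add: a_def algebra_simps)
    note p = solution_period[OF sol w l, of "a j" A, folded e]
    show "\<psi> (a (Suc j)) = tm11 b \<theta> *\<^sub>R \<psi> (a j) + (tm12 b \<theta> / w) *\<^sub>R left_deriv \<psi> (a j)"
      "left_deriv \<psi> (a (Suc j)) = (w * tm21 b \<theta>) *\<^sub>R \<psi> (a j) + tm22 b \<theta> *\<^sub>R left_deriv \<psi> (a j)"
      unfolding b_def \<theta>_def using z truncated_comb_at[OF l that, of A]
      by (intro p; simp add: a_def algebra_simps)+
  qed
  \<comment> \<open>The factors \<open>1 / w\<close> and \<open>w\<close> from the change to the
    coordinates \<open>(\<psi>, \<psi>')\<close> cancel, so the determinant is unchanged.\<close>
  have det: "tm11 b \<theta> * tm22 b \<theta> - tm12 b \<theta> / w * (w * tm21 b \<theta>) = 1"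
    using tm_det w by simp
  have a: "a 0 = 0" "a (Suc j) = c" by (simp_all add: a_def c_def N)
  note m = matrix_iterates_cheb[of "tm11 b \<theta>" "tm22 b \<theta>" f "tm12 b \<theta> / w" "w * tm21 b \<theta>" N
      "\<lambda>j. \<psi> (a j)" "\<lambda>j. left_deriv \<psi> (a j)" j, OF tm_trace[of b \<theta>, folded f_def] det step, unfolded a]
  show ?thesis1 ?thesis2 using m by (simp_all add: N)
qed

lemma transmission_coefficient_eq:
  assumes l: "l > 0" and w: "w > 0" and N: "N \<ge> 1"
  shows "(cmod (transmission_coefficient l A N w))\<^sup>2 =
    4 / ((cheb N (tm_half_trace (A / w) (w * l)))\<^sup>2
      * ((A / w)\<^sup>2 * ((sin (w * l))\<^sup>2 * (4 + (A / w)\<^sup>2))) + 4)"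
proof -
  from N obtain j where j: "N = Suc j" by (cases N) auto
  define b \<theta> where "b = A / w" and "\<theta> = w * l"
  define f where "f = tm_half_trace b \<theta>"
  define c where "c = real (2 * N) * l"
  let ?q = "truncated_comb l A N"
  \<comment> \<open>The entries of the \<open>N\<close>-th power of the transfer matrix in the
    normalised coordinates \<open>(\<psi>, \<psi>' / w)\<close>.\<close>
  define m11 m12 m21 m22 where "m11 = cheb N f * tm11 b \<theta> - cheb j f" and "m12 = cheb N f * tm12 b \<theta>"
    and "m21 = cheb N f * tm21 b \<theta>" and "m22 = cheb N f * tm22 b \<theta> - cheb j f"
  have w0: "w \<noteq> 0" using w by simp
  have "m11 * m22 - m12 * m21 = (cheb N f)\<^sup>2 - 2 * f * cheb N f * cheb j f + (cheb j f)\<^sup>2"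
    unfolding m11_def m12_def m21_def m22_def
    using tm_det[of b \<theta>] tm_trace[of b \<theta>, folded f_def] by algebra
  then have det: "m11 * m22 - m12 * m21 = 1"
    using cheb_quadratic[of j f] by (simp add: j)
  define D where "D = Complex (m11 + m22) (m21 - m12)"
  note sys = scattering_linear_system[OF det, folded D_def]
  \<comment> \<open>The phase of the outgoing wave at \<open>c\<close>; being unimodular, it does
    not affect \<open>|t|\<close>.\<close>
  define P where "P = exp (\<i> * of_real (w * c))"
  have P: "P \<noteq> 0" "cmod P = 1" by (simp_all add: P_def)
  have scat: "scattering_solution l A N w \<psi> r t \<longleftrightarrow>
      schroedinger_solution ?q (w\<^sup>2) \<psi> \<and> \<psi> 0 = 1 + r \<and> left_deriv \<psi> 0 = \<i> * of_real w * (1 - r) \<and>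
      t * P = 2 / D \<and> r = t * P * Complex m22 (- m12) - 1" for \<psi> r t
  proof -
    have "\<psi> c = t * P \<and> left_deriv \<psi> c = \<i> * of_real w * (t * P) \<longleftrightarrow>
        t * P = 2 / D \<and> r = t * P * Complex m22 (- m12) - 1"
      if sol: "schroedinger_solution ?q (w\<^sup>2) \<psi>" and 0: "\<psi> 0 = 1 + r" "left_deriv \<psi> 0 = \<i> * of_real w * (1 - r)"
    proof -
      have "\<psi> c = m11 *\<^sub>R (1 + r) + (m12 / w) *\<^sub>R (\<i> * of_real w * (1 - r))"
        "left_deriv \<psi> c = (w * m21) *\<^sub>R (1 + r) + m22 *\<^sub>R (\<i> * of_real w * (1 - r))"
        using solution_truncated_comb[OF sol l w0 j, folded b_def \<theta>_def c_def, folded f_def] 0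
        by (simp_all add: m11_def m12_def m21_def m22_def algebra_simps)
      then have "\<psi> c = of_real m11 * (1 + r) + of_real m12 * (\<i> * (1 - r))"
        "left_deriv \<psi> c = of_real w * (of_real m21 * (1 + r) + of_real m22 * (\<i> * (1 - r)))"
        using w0 by (simp_all add: scaleR_conv_of_real algebra_simps)
      moreover have "of_real w * z = \<i> * of_real w * (t * P) \<longleftrightarrow> z = \<i> * (t * P)" for z :: complex
        using w0 by (auto simp: algebra_simps)
      ultimately show ?thesis using sys(1)[of r "t * P"] by simp
    qed
    then show ?thesis
      unfolding scattering_solution_iff[OF l w, of A N \<psi> r t, folded c_def, folded P_def] by blast
  qed
  have "transmission_coefficient l A N w = 2 / D / P"
    unfolding transmission_coefficient_def
  proof (rule the_equality)
    \<comment> \<open>Existence: the linear system prescribes \<open>r\<close>, and a solution with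
      the corresponding data at \<open>0\<close> exists. Uniqueness of \<open>t\<close> follows from
      \<open>t * P = 2 / D\<close>.\<close>
    define r where "r = 2 / D * Complex m22 (- m12) - 1"
    obtain \<psi> where "schroedinger_solution ?q (w\<^sup>2) \<psi>" "\<psi> 0 = 1 + r"
        "left_deriv \<psi> 0 = \<i> * of_real w * (1 - r)"
      using lattice_solution_exists[OF l w0, of ?q "1 + r"] truncated_comb_support by metis
    then have "scattering_solution l A N w \<psi> r (2 / D / P)"
      unfolding scat using P(1) by (simp add: r_def)
    then show "\<exists>\<psi> r. scattering_solution l A N w \<psi> r (2 / D / P)" by blast
    fix t assume "\<exists>\<psi> r. scattering_solution l A N w \<psi> r t"
    then have "t * P = 2 / D" unfolding scat by blast
    then show "t = 2 / D / P" using P(1) by (metis nonzero_mult_div_cancel_right)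
  qed
  then have "(cmod (transmission_coefficient l A N w))\<^sup>2 = (cmod (2 / D))\<^sup>2"
    using P(2) by (simp add: norm_divide norm_mult)
  also have "\<dots> = 4 / ((m11 - m22)\<^sup>2 + (m12 + m21)\<^sup>2 + 4)" by (rule sys(2))
  \<comment> \<open>The multiple \<open>cheb j f\<close> of the identity cancels in the difference
    of the diagonal entries.\<close>
  also have "(m11 - m22)\<^sup>2 + (m12 + m21)\<^sup>2
      = (cheb N f)\<^sup>2 * ((tm11 b \<theta> - tm22 b \<theta>)\<^sup>2 + (tm12 b \<theta> + tm21 b \<theta>)\<^sup>2)"
    unfolding m11_def m12_def m21_def m22_def by algebra
  finally show ?thesis unfolding tm_anisotropy f_def b_def \<theta>_def .
qed

subsection \<open>The asymptotics\<close>

text \<open>The deviation is \<open>u = \<eta> * (X / (X + 4))\<close>, with the second factor in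
  \<open>[0, 1)\<close>. The bound is exact for each \<open>A\<close> and involves neither
  \<open>N\<close> nor \<open>k\<close>.\<close>

lemma transmission_ratio_near_1:
  assumes l: "l > 0" and w: "w > 0" and N: "N \<ge> 1" and k: "cos k = complex_of_real (half_trace l A w)"
  defines "\<eta> \<equiv> (sin (w * l))\<^sup>2 * (4 + (A / w)\<^sup>2) / 4"
  shows "\<exists>u. \<bar>u\<bar> \<le> \<eta> \<and>
    complex_of_real ((cmod (transmission_coefficient l A N w))\<^sup>2) /
      (4 / (complex_of_real (A\<^sup>2 / w\<^sup>2) * (sin (of_nat N * k))\<^sup>2 + 4)) = complex_of_real (1 - u)"
proof -
  define f where "f = tm_half_trace (A / w) (w * l)"
  define X where "X = (cheb N f)\<^sup>2 * ((A / w)\<^sup>2 * ((sin (w * l))\<^sup>2 * (4 + (A / w)\<^sup>2)))"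
  have X: "X \<ge> 0" by (simp add: X_def)
  have \<eta>: "\<eta> \<ge> 0" by (simp add: \<eta>_def)
  have cos: "cos k = of_real f" using k half_trace_eq[OF l, of w A] w by (simp add: f_def)
  have "(sin (of_nat N * k))\<^sup>2 = (cheb N (cos k))\<^sup>2 * (1 - (cos k)\<^sup>2)"
    by (simp add: sin_nat_mult power_mult_distrib sin_squared_eq)
  also have "\<dots> = of_real ((cheb N f)\<^sup>2 * (1 - f\<^sup>2))"
    by (simp add: cos cheb_of_real)
  also have "1 - f\<^sup>2 = (sin (w * l))\<^sup>2 * (4 + (A / w)\<^sup>2) * (1 - \<eta>)"
    unfolding f_def one_minus_tm_half_trace_square \<eta>_def ..
  finally have "complex_of_real (A\<^sup>2 / w\<^sup>2) * (sin (of_nat N * k))\<^sup>2 + 4 = of_real (X * (1 - \<eta>) + 4)"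
    by (simp add: X_def power_divide)
  moreover have "(cmod (transmission_coefficient l A N w))\<^sup>2 = 4 / (X + 4)"
    using transmission_coefficient_eq[OF l w N] by (simp only: X_def f_def)
  ultimately have "complex_of_real ((cmod (transmission_coefficient l A N w))\<^sup>2) /
      (4 / (complex_of_real (A\<^sup>2 / w\<^sup>2) * (sin (of_nat N * k))\<^sup>2 + 4))
      = of_real ((4 / (X + 4)) / (4 / (X * (1 - \<eta>) + 4)))"
    by (simp only: of_real_divide of_real_numeral)
  \<comment> \<open>This also holds if \<open>X * (1 - \<eta>) + 4\<close> is zero, where division
    by zero makes both sides zero.\<close>
  also have "(4 / (X + 4)) / (4 / (X * (1 - \<eta>) + 4)) = (X * (1 - \<eta>) + 4) / (X + 4)"
    by (simp only: divide_divide_eq_right divide_divide_eq_left) (simp add: field_simps add_nonneg_eq_0_iff X)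
  also have "(X * (1 - \<eta>) + 4) / (X + 4) = 1 - \<eta> * (X / (X + 4))"
    using X by (simp add: field_simps)
  finally have "complex_of_real ((cmod (transmission_coefficient l A N w))\<^sup>2) /
      (4 / (complex_of_real (A\<^sup>2 / w\<^sup>2) * (sin (of_nat N * k))\<^sup>2 + 4))
      = of_real (1 - \<eta> * (X / (X + 4)))" .
  moreover have "\<bar>\<eta> * (X / (X + 4))\<bar> \<le> \<eta>"
    using X \<eta> mult_left_le[of "X / (X + 4)" \<eta>] by (subst abs_of_nonneg) simp_all
  ultimately show ?thesis by blast
qed

text \<open>Shifting the argument by \<open>n \<pi>\<close> changes the sine only in sign, and
  \<open>|sin y| \<le> |y|\<close>.\<close>

lemma abs_sin_diff_le: "\<bar>sin (x * l)\<bar> \<le> l * \<bar>x - real n * pi / l\<bar>" if "l > 0" for x l :: real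
proof -
  have "x * l = l * (x - real n * pi / l) + real n * pi" using that by (simp add: field_simps)
  then have "\<bar>sin (x * l)\<bar> = \<bar>sin (l * (x - real n * pi / l))\<bar>"
    by (simp only: sin_add) (simp add: cos_npi abs_mult power_abs)
  also have "\<dots> \<le> \<bar>l * (x - real n * pi / l)\<bar>" by (rule abs_sin_x_le_abs_x)
  finally show ?thesis using that by (simp add: abs_mult)
qed

lemma dist_center_le_measure:
  assumes "interval_centered_at c S" "x \<in> S"
  shows "\<bar>x - c\<bar> \<le> measure lborel S"
proof -
  obtain r where r: "r > 0" "S = {c - r<..<c + r} \<or> S = {c - r..c + r}"
    using assms(1) by (auto simp: interval_centered_at_def)
  then have "measure lborel S = 2 * r" by auto
  moreover have "\<bar>x - c\<bar> \<le> r" using r assms(2) by auto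
  ultimately show ?thesis using r(1) by simp
qed

theorem theorem7:
  fixes l L :: real and n N :: nat
    and \<Delta> :: "real \<Rightarrow> real set" and k :: "real \<Rightarrow> real \<Rightarrow> complex"
  assumes "l > 0" and "L = 2 * l" and "n \<ge> 1" and "N \<ge> 1"
    and "\<forall>A>0. interval_centered_at (real n * pi / l) (\<Delta> A)"
    and "(\<lambda>A. measure lborel (\<Delta> A)) \<in> o[at_top](\<lambda>A. 1 / A)"
    and "\<forall>A>0. \<forall>w\<in>\<Delta> A. cos (k A w) = complex_of_real (half_trace l A w)"
  shows "(\<forall>A>0. \<forall>w. w \<noteq> 0 \<longrightarrow>
            half_trace l A w = cos (w * L) - A\<^sup>2 / (2 * w\<^sup>2) * (sin (w * l))\<^sup>2) \<and>
         (\<forall>\<omega> :: real \<Rightarrow> real. (\<forall>A>0. \<omega> A \<in> \<Delta> A) \<longrightarrow>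
            ((\<lambda>A. complex_of_real ((cmod (transmission_coefficient l A N (\<omega> A)))\<^sup>2) /
                  (4 / (complex_of_real (A\<^sup>2 / (\<omega> A)\<^sup>2) * (sin (of_nat N * k A (\<omega> A)))\<^sup>2 + 4)))
              \<longlongrightarrow> 1) at_top)"
proof (intro conjI allI impI)
  fix A w :: real
  assume "w \<noteq> 0"
  then show "half_trace l A w = cos (w * L) - A\<^sup>2 / (2 * w\<^sup>2) * (sin (w * l))\<^sup>2"
    using half_trace_eq[OF \<open>l > 0\<close>, of w A] \<open>L = 2 * l\<close> by (simp add: tm_half_trace_def power_divide mult_ac)
next
  fix \<omega> :: "real \<Rightarrow> real"
  assume \<omega>: "\<forall>A>0. \<omega> A \<in> \<Delta> A"
  note l = \<open>l > 0\<close>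
  define c where "c = real n * pi / l"
  have c: "c > 0" using l \<open>n \<ge> 1\<close> by (simp add: c_def)
  define \<mu> where "\<mu> = (\<lambda>A. measure lborel (\<Delta> A))"
  define s where "s = (\<lambda>A. sin (\<omega> A * l))"
  have le: "\<bar>\<omega> A - c\<bar> \<le> \<mu> A" if "A > 0" for A
    unfolding \<mu>_def c_def using that \<omega> assms(5) by (intro dist_center_le_measure) auto
  have A\<mu>: "((\<lambda>A. A * \<mu> A) \<longlongrightarrow> 0) at_top"
    using smalloD_tendsto[OF assms(6)] by (simp add: \<mu>_def mult.commute)
  \<comment> \<open>The rate \<open>A * \<mu> A \<longlongrightarrow> 0\<close> forces the length
    itself to vanish, so \<open>\<omega> A\<close> tends to the centre \<open>c\<close>.\<close>
  have "((\<lambda>A. inverse A * (A * \<mu> A)) \<longlongrightarrow> 0 * 0) at_top"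
    by (intro tendsto_mult A\<mu> tendsto_inverse_0_at_top filterlim_ident)
  moreover have "eventually (\<lambda>A. inverse A * (A * \<mu> A) = \<mu> A) at_top"
    using eventually_gt_at_top[of "0::real"] by eventually_elim simp
  ultimately have \<mu>: "(\<mu> \<longlongrightarrow> 0) at_top" by (simp only: mult_zero_right Lim_transform_eventually)
  have "((\<lambda>A. \<omega> A - c) \<longlongrightarrow> 0) at_top"
    by (rule Lim_null_comparison[OF _ \<mu>]) (rule eventually_mono[OF eventually_gt_at_top[of 0]], simp add: le)
  then have \<omega>c: "(\<omega> \<longlongrightarrow> c) at_top" by (simp add: LIM_zero_iff)
  \<comment> \<open>The transmission formula requires a positive frequency; \<open>c > 0\<close>
    because \<open>n \<ge> 1\<close>.\<close>
  then have pos: "eventually (\<lambda>A. \<omega> A > 0) at_top" using c by (rule order_tendstoD)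
  have sle: "\<bar>s A\<bar> \<le> l * \<mu> A" if "A > 0" for A
    using abs_sin_diff_le[OF l, of "\<omega> A" n, folded c_def] le[OF that] l
    by (auto simp: s_def intro: order_trans)
  have "(s \<longlongrightarrow> 0) at_top"
    by (rule Lim_null_comparison[OF _ tendsto_mult_right_zero[OF \<mu>, of l]])
      (rule eventually_mono[OF eventually_gt_at_top[of 0]], simp add: sle)
  moreover have "((\<lambda>A. s A * A) \<longlongrightarrow> 0) at_top"
  proof (rule Lim_null_comparison[OF _ tendsto_mult_right_zero[OF A\<mu>, of l]])
    show "\<forall>\<^sub>F A in at_top. norm (s A * A) \<le> l * (A * \<mu> A)"
      using eventually_gt_at_top[of "0::real"]
    proof eventually_elim
      case (elim A)
      then have "\<bar>s A\<bar> * A \<le> (l * \<mu> A) * A" using sle by (intro mult_right_mono) auto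
      then show ?case using elim by (simp add: abs_mult mult_ac)
    qed
  qed
  \<comment> \<open>\<open>\<eta>\<close> is split into \<open>s\<^sup>2\<close> and a multiple of
    \<open>(s A / \<omega>)\<^sup>2\<close>; the second part needs the full rate
    \<open>o(1 / A)\<close>, while \<open>\<omega>\<close> stays near \<open>c > 0\<close>.\<close>
  ultimately have "((\<lambda>A. (s A)\<^sup>2 + (s A * A / \<omega> A)\<^sup>2 / 4) \<longlongrightarrow> 0\<^sup>2 + (0 / c)\<^sup>2 / 4) at_top"
    using \<omega>c c by (intro tendsto_intros) auto
  moreover have "(s A)\<^sup>2 + (s A * A / \<omega> A)\<^sup>2 / 4 = (s A)\<^sup>2 * (4 + (A / \<omega> A)\<^sup>2) / 4" for A
    by (simp add: field_simps power2_eq_square)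
  ultimately have \<eta>: "((\<lambda>A. (s A)\<^sup>2 * (4 + (A / \<omega> A)\<^sup>2) / 4) \<longlongrightarrow> 0) at_top" by simp
  let ?R = "\<lambda>A. complex_of_real ((cmod (transmission_coefficient l A N (\<omega> A)))\<^sup>2) /
      (4 / (complex_of_real (A\<^sup>2 / (\<omega> A)\<^sup>2) * (sin (of_nat N * k A (\<omega> A)))\<^sup>2 + 4))"
  have "((\<lambda>A. ?R A - 1) \<longlongrightarrow> 0) at_top"
  proof (rule Lim_null_comparison[OF _ \<eta>])
    show "\<forall>\<^sub>F A in at_top. norm (?R A - 1) \<le> (s A)\<^sup>2 * (4 + (A / \<omega> A)\<^sup>2) / 4"
      using eventually_gt_at_top[of "0::real"] pos
    proof eventually_elim
      case (elim A)
      then obtain u where "\<bar>u\<bar> \<le> (s A)\<^sup>2 * (4 + (A / \<omega> A)\<^sup>2) / 4" "?R A = of_real (1 - u)"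
        using transmission_ratio_near_1[OF l, of "\<omega> A" N "k A (\<omega> A)" A] \<open>N \<ge> 1\<close> assms(7) \<omega> unfolding s_def by blast
      moreover have "norm (complex_of_real (1 - u) - 1) = \<bar>u\<bar>" by simp
      ultimately show ?case by (simp only:)
    qed
  qed
  then show "(?R \<longlongrightarrow> 1) at_top" by (simp add: LIM_zero_iff)
qed

end
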